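(* Let $G$ be a group with subgroups $A, B \leq G$ such that $G$ is the inner semidirect product $G = [AB]$, and let $S \subseteq G$ be atomic, i.e. $S \subseteq A \cup B$. Then $$\langle S \rangle = \left[\mathcal{A}_{\langle S \rangle}\, \mathcal{B}_{\langle S \rangle}\right],$$ where $$\mathcal{A}_{\langle S \rangle} := \langle S \rangle \cap A = \langle \mathcal{A}_S^+ \rangle = \varphi_A(\langle S \rangle), \qquad \mathcal{B}_{\langle S \rangle} := \langle S \rangle \cap B = \langle \mathcal{B}_S \rangle = \varphi_B(\langle S \rangle).$$ Here $\mathcal{A}_S := S \cap A$, $\mathcal{B}_S := S\cap B$, and $\mathcal{A}_S^+ := \{\, b a' b^{-1} \mid a' \in \mathcal{A}_S,\ b \in \mathcal{B}_{\langle S \rangle} \,\}$.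
   Context: For subgroups $A,B$ of a group $G$, the notation $[AB]$ (inner semidirect product) means the product set $AB=\{ab \mid a\in A, b\in B\}$ together with the requirements that $B$ is contained in the normalizer $N_G(A)$ of $A$ in $G$ and that $A\cap B=\{e\}$; so an equality $K=[AB]$ asserts $K = AB$ and that both of these conditions hold. If $G=[AB]$, every $g\in G$ can be written uniquely as $g=ab$ with $a\in A$, $b\in B$; the functions $\varphi_A:G\to A$ and $\varphi_B:G\to B$ are defined by $g=\varphi_A(g)\varphi_B(g)$. For a subset $T\subseteq G$, $\langle T\rangle$ is the subgroup generated by $T$, and $\varphi_A(T)$, $\varphi_B(T)$ denote images. *)

theory Defs
  imports "HOL-Algebra.Algebra"
begin

text \<open>
  \<open>inner_semidirect G K A B\<close> renders the assertion \<open>K = [AB]\<close> inside \<open>G\<close>.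
  The notation presupposes subgroups \<open>A\<close> and \<open>B\<close>, so this is part of the definition.
\<close>

definition inner_semidirect ::
  "('a, 'm) monoid_scheme \<Rightarrow> 'a set \<Rightarrow> 'a set \<Rightarrow> 'a set \<Rightarrow> bool" where
  "inner_semidirect G K A B \<longleftrightarrow>
     subgroup A G \<and> subgroup B G \<and>
     K = A <#>\<^bsub>G\<^esub> B \<and> B \<subseteq> normalizer G A \<and> A \<inter> B = {\<one>\<^bsub>G\<^esub>}"

definition proj_left ::
  "('a, 'm) monoid_scheme \<Rightarrow> 'a set \<Rightarrow> 'a set \<Rightarrow> 'a \<Rightarrow> 'a" where
  "proj_left G A B g = (THE a. a \<in> A \<and> (\<exists>b\<in>B. g = a \<otimes>\<^bsub>G\<^esub> b))"

definition proj_right ::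
  "('a, 'm) monoid_scheme \<Rightarrow> 'a set \<Rightarrow> 'a set \<Rightarrow> 'a \<Rightarrow> 'a" where
  "proj_right G A B g = (THE b. b \<in> B \<and> (\<exists>a\<in>A. g = a \<otimes>\<^bsub>G\<^esub> b))"

definition left_part_conj ::
  "('a, 'm) monoid_scheme \<Rightarrow> 'a set \<Rightarrow> 'a set \<Rightarrow> 'a set \<Rightarrow> 'a set" where
  "left_part_conj G A B S =
     {b \<otimes>\<^bsub>G\<^esub> a \<otimes>\<^bsub>G\<^esub> inv\<^bsub>G\<^esub> b |a b. a \<in> S \<inter> A \<and> b \<in> generate G S \<inter> B}"

lemma inner_semidirect_unique:
  assumes "group G" "inner_semidirect G K A B"
    and "a \<in> A" "a' \<in> A" "b \<in> B" "b' \<in> B"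
    and eq: "a \<otimes>\<^bsub>G\<^esub> b = a' \<otimes>\<^bsub>G\<^esub> b'"
  shows "a = a' \<and> b = b'"
proof -
  interpret group G by fact
  have A: "subgroup A G" and B: "subgroup B G" and I: "A \<inter> B = {\<one>\<^bsub>G\<^esub>}"
    using assms(2) by (auto simp: inner_semidirect_def)
  have c: "a \<in> carrier G" "a' \<in> carrier G" "b \<in> carrier G" "b' \<in> carrier G"
    using assms A B by (auto dest: subgroup.mem_carrier)
  have "inv\<^bsub>G\<^esub> a' \<otimes>\<^bsub>G\<^esub> (a \<otimes>\<^bsub>G\<^esub> b) = b'"
    using eq c by (simp add: m_assoc[symmetric])
  then have x: "inv\<^bsub>G\<^esub> a' \<otimes>\<^bsub>G\<^esub> a = b' \<otimes>\<^bsub>G\<^esub> inv\<^bsub>G\<^esub> b"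
    using c by (metis inv_closed inv_solve_right m_assoc m_closed)
  have "inv\<^bsub>G\<^esub> a' \<otimes>\<^bsub>G\<^esub> a \<in> A"
    using assms A by (simp add: subgroup.m_closed subgroup.m_inv_closed)
  moreover have "b' \<otimes>\<^bsub>G\<^esub> inv\<^bsub>G\<^esub> b \<in> B"
    using assms B by (simp add: subgroup.m_closed subgroup.m_inv_closed)
  ultimately have "inv\<^bsub>G\<^esub> a' \<otimes>\<^bsub>G\<^esub> a = \<one>\<^bsub>G\<^esub>"
    using x I by auto
  then have "a = a'" using c by (metis inv_closed inv_equality inv_inv)
  then show ?thesis using eq c by simp
qed

lemma proj_mult:
  assumes "group G" "inner_semidirect G K A B" "a \<in> A" "b \<in> B"
  shows "proj_left G A B (a \<otimes>\<^bsub>G\<^esub> b) = a" "proj_right G A B (a \<otimes>\<^bsub>G\<^esub> b) = b"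
  unfolding proj_left_def proj_right_def
  using assms inner_semidirect_unique[OF assms(1,2)] by (blast intro: the_equality)+

end

theory Submission
  imports Defs
begin

text \<open>
  Let \<open>N\<close> be generated by the conjugates of \<open>S \<inter> A\<close> under \<open>\<langle>S\<rangle> \<inter> B\<close>, and \<open>M\<close> by \<open>S \<inter> B\<close>.
  Conjugation by \<open>\<langle>S\<rangle> \<inter> B\<close> permutes the generators of \<open>N\<close>, so \<open>M\<close> normalizes \<open>N\<close>; hence the
  product set \<open>N M\<close> is closed under multiplication and, since \<open>S\<close> is atomic, contains \<open>S\<close> and
  the inverses of its elements. Thus \<open>\<langle>S\<rangle> = N M\<close> with \<open>N \<subseteq> A\<close> and \<open>M \<subseteq> B\<close>, and uniqueness
  of the factorization in \<open>G = [AB]\<close> gives all the claimed equalities.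
\<close>

lemma (in group) conj_mult:
  assumes "g \<in> carrier G" "x \<in> carrier G" "y \<in> carrier G"
  shows "g \<otimes> (x \<otimes> y) \<otimes> inv g = (g \<otimes> x \<otimes> inv g) \<otimes> (g \<otimes> y \<otimes> inv g)"
proof -
  have "inv g \<otimes> (g \<otimes> z) = z" if "z \<in> carrier G" for z
    using assms that by (simp add: m_assoc[symmetric])
  then show ?thesis
    using assms by (simp add: m_assoc)
qed

lemma (in group) conj_inv:
  assumes "g \<in> carrier G" "x \<in> carrier G"
  shows "g \<otimes> inv x \<otimes> inv g = inv (g \<otimes> x \<otimes> inv g)"
  using assms by (simp add: inv_mult_group m_assoc)

lemma (in group) mem_conj_set_iff:
  "x \<in> g <# H #> inv g \<longleftrightarrow> (\<exists>h\<in>H. x = g \<otimes> h \<otimes> inv g)"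
  by (auto simp: l_coset_def r_coset_def)

text \<open>The normalizer is a stabilizer under conjugation, so membership of \<open>k\<close>
  means the equality \<open>k <# H #> inv k = H\<close>. One inclusion for every \<open>k\<close> in
  \<open>K\<close> already yields equality: \<open>K\<close> is closed under inverses, and the
  inclusion for \<open>inv k\<close> is the reverse inclusion for \<open>k\<close>.\<close>

lemma (in group) subset_normalizer_iff:
  assumes "subgroup H G" "subgroup K G"
  shows "K \<subseteq> normalizer G H \<longleftrightarrow> (\<forall>k\<in>K. \<forall>h\<in>H. k \<otimes> h \<otimes> inv k \<in> H)"
proof -
  have HK: "H \<subseteq> carrier G" "K \<subseteq> carrier G"
    using assms by (auto dest: subgroup.subset)
  have "k <# H #> inv k = H"
    if conj: "\<forall>k\<in>K. \<forall>h\<in>H. k \<otimes> h \<otimes> inv k \<in> H" and k: "k \<in> K" for k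
  proof
    have kc: "k \<in> carrier G" using k HK by auto
    show "k <# H #> inv k \<subseteq> H"
      using conj k HK kc by (auto simp: mem_conj_set_iff)
    show "H \<subseteq> k <# H #> inv k"
    proof
      fix h assume h: "h \<in> H"
      have hc: "h \<in> carrier G" using h HK by auto
      have "inv k \<otimes> h \<otimes> k \<in> H"
        using conj[rule_format, OF subgroup.m_inv_closed[OF assms(2) k] h] kc by simp
      moreover have "h = k \<otimes> (inv k \<otimes> h \<otimes> k) \<otimes> inv k"
        using kc hc by (metis inv_closed m_assoc m_closed r_inv l_one r_one)
      ultimately show "h \<in> k <# H #> inv k"
        unfolding mem_conj_set_iff by blast
    qed
  qed
  moreover have "k \<otimes> h \<otimes> inv k \<in> H"
    if "k <# H #> inv k = H" "k \<in> K" "h \<in> H" for k h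
    using that HK mem_conj_set_iff[of _ k H] by blast
  ultimately show ?thesis
    using HK by (auto simp: normalizer_def stabilizer_def)
qed

text \<open>Conjugation by \<open>g\<close> respects products and inverses, so stability of the
  generating set passes to the generated subgroup by induction on \<open>generate\<close>.\<close>

lemma (in group) generate_conj_closed:
  assumes "T \<subseteq> carrier G" "g \<in> carrier G"
    and "\<And>t. t \<in> T \<Longrightarrow> g \<otimes> t \<otimes> inv g \<in> T"
    and "x \<in> generate G T"
  shows "g \<otimes> x \<otimes> inv g \<in> generate G T"
  using assms(4)
proof (induction rule: generate.induct)
  case one
  then show ?case using assms by (simp add: generate.one)
next
  case (incl h)
  then show ?case using assms by (simp add: generate.incl)
next
  case (inv h)
  then have "h \<in> carrier G" using assms by auto
  then show ?case using assms inv by (simp add: conj_inv generate.inv)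
next
  case (eng h1 h2)
  then show ?case
    using assms generate_in_carrier[OF assms(1)] by (simp add: conj_mult generate.eng)
qed

text \<open>The product set absorbs products because \<open>M\<close> normalizes \<open>N\<close>: a
  factor from \<open>M\<close> can be moved to the right past a factor from \<open>N\<close> at the
  cost of conjugating the latter.\<close>

lemma (in group) generate_subset_set_mult:
  assumes "subgroup N G" "subgroup M G"
    and conj: "\<And>m n. m \<in> M \<Longrightarrow> n \<in> N \<Longrightarrow> m \<otimes> n \<otimes> inv m \<in> N"
    and "T \<subseteq> N \<union> M"
  shows "generate G T \<subseteq> N <#> M"
proof
  have c: "N \<subseteq> carrier G" "M \<subseteq> carrier G"
    using assms by (auto dest: subgroup.subset)
  have N: "n \<in> N <#> M" if "n \<in> N" for n
    using that c subgroup.one_closed[OF assms(2)] r_one[of n]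
    unfolding set_mult_def by force
  have M: "m \<in> N <#> M" if "m \<in> M" for m
    using that c subgroup.one_closed[OF assms(1)] l_one[of m]
    unfolding set_mult_def by force
  fix x assume "x \<in> generate G T"
  then show "x \<in> N <#> M"
  proof (induction rule: generate.induct)
    case one
    then show ?case using N subgroup.one_closed[OF assms(1)] by simp
  next
    case (incl h)
    then show ?case using N M assms(4) by auto
  next
    \<comment> \<open>The inductive definition of \<open>generate\<close> inverts generators only.
      Such an \<open>h\<close> lies in \<open>N\<close> or in \<open>M\<close>, and each of these is
      closed under inverses.\<close>
    case (inv h)
    then show ?case using N M assms(4) subgroup.m_inv_closed[OF assms(1)]
        subgroup.m_inv_closed[OF assms(2)] by auto
  next
    case (eng h1 h2)
    then obtain n1 m1 n2 m2 where h: "n1 \<in> N" "m1 \<in> M" "h1 = n1 \<otimes> m1"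
        "n2 \<in> N" "m2 \<in> M" "h2 = n2 \<otimes> m2"
      by (auto simp: set_mult_def)
    then have hc: "n1 \<in> carrier G" "m1 \<in> carrier G" "n2 \<in> carrier G" "m2 \<in> carrier G"
      using c by auto
    then have "inv m1 \<otimes> (m1 \<otimes> m2) = m2"
      by (simp add: m_assoc[symmetric])
    \<comment> \<open>Inserting \<open>inv m1 \<otimes> m1\<close> after \<open>n2\<close> collects
      the \<open>N\<close>-parts on the left and the \<open>M\<close>-parts on the right.\<close>
    then have "h1 \<otimes> h2 = (n1 \<otimes> (m1 \<otimes> n2 \<otimes> inv m1)) \<otimes> (m1 \<otimes> m2)"
      using h hc by (simp add: m_assoc)
    moreover have "n1 \<otimes> (m1 \<otimes> n2 \<otimes> inv m1) \<in> N" "m1 \<otimes> m2 \<in> M"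
      using h conj assms(1,2) by (auto intro: subgroup.m_closed)
    ultimately show ?case
      unfolding set_mult_def by blast
  qed
qed

theorem theorem5p1:
  fixes G :: "('a, 'm) monoid_scheme" and A B S :: "'a set"
  assumes "group G"
    and "subgroup A G" and "subgroup B G"
    and "inner_semidirect G (carrier G) A B"
    and "S \<subseteq> carrier G" and "S \<subseteq> A \<union> B"
  shows "inner_semidirect G (generate G S) (generate G S \<inter> A) (generate G S \<inter> B) \<and>
         generate G S \<inter> A = generate G (left_part_conj G A B S) \<and>
         generate G S \<inter> A = proj_left G A B ` generate G S \<and>
         generate G S \<inter> B = generate G (S \<inter> B) \<and>
         generate G S \<inter> B = proj_right G A B ` generate G S"
proof -
  interpret group G by fact
  define H where "H = generate G S"
  define T where "T = left_part_conj G A B S"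
  define N where "N = generate G T"
  define M where "M = generate G (S \<inter> B)"
  note proj = proj_mult[OF assms(1,4)] and unique = inner_semidirect_unique[OF assms(1,4)]
  have A1: "\<one>\<^bsub>G\<^esub> \<in> A" and B1: "\<one>\<^bsub>G\<^esub> \<in> B"
    using assms(2,3) by (auto intro: subgroup.one_closed)
  have Ac: "A \<subseteq> carrier G" and Bc: "B \<subseteq> carrier G"
    using assms(2,3) by (auto dest: subgroup.subset)
  have AB: "b \<otimes>\<^bsub>G\<^esub> a \<otimes>\<^bsub>G\<^esub> inv\<^bsub>G\<^esub> b \<in> A" if "b \<in> B" "a \<in> A" for a b
    using assms(4) that subset_normalizer_iff[OF assms(2,3)] by (auto simp: inner_semidirect_def)
  have H: "subgroup H G"
    unfolding H_def by (rule generate_is_subgroup[OF assms(5)])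
  have SH: "S \<subseteq> H"
    by (auto simp: H_def intro: generate.incl)
  have HA: "subgroup (H \<inter> A) G" and HB: "subgroup (H \<inter> B) G"
    using H assms(2,3) by (auto intro: subgroups_Inter_pair)
  have H_conj: "b \<otimes>\<^bsub>G\<^esub> a \<otimes>\<^bsub>G\<^esub> inv\<^bsub>G\<^esub> b \<in> H \<inter> A" if "b \<in> H \<inter> B" "a \<in> H \<inter> A" for a b
    using that AB H by (auto intro: subgroup.m_closed subgroup.m_inv_closed)
  \<comment> \<open>The conjugators range over all of \<open>H \<inter> B\<close>, which is only
    later identified with \<open>M\<close>. Since they form a subgroup, \<open>T\<close> is stable
    under conjugation by each of them.\<close>
  have T_eq: "T = {b \<otimes>\<^bsub>G\<^esub> a \<otimes>\<^bsub>G\<^esub> inv\<^bsub>G\<^esub> b |a b. a \<in> S \<inter> A \<and> b \<in> H \<inter> B}"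
    by (simp add: T_def H_def left_part_conj_def)
  have THA: "T \<subseteq> H \<inter> A"
    using H_conj SH unfolding T_eq by blast
  have Tc: "T \<subseteq> carrier G"
    using THA Ac by blast
  have N: "subgroup N G" "N \<subseteq> H \<inter> A"
    unfolding N_def using generate_is_subgroup[OF Tc] generate_subgroup_incl[OF THA HA] by auto
  have M: "subgroup M G" "M \<subseteq> H \<inter> B"
    unfolding M_def using generate_is_subgroup[of "S \<inter> B"] generate_subgroup_incl[OF _ HB, of "S \<inter> B"]
      SH assms(5) by auto
  have T_conj: "c \<otimes>\<^bsub>G\<^esub> t \<otimes>\<^bsub>G\<^esub> inv\<^bsub>G\<^esub> c \<in> T" if c: "c \<in> H \<inter> B" and t: "t \<in> T" for c t
  proof -
    obtain a b where ab: "a \<in> S \<inter> A" "b \<in> H \<inter> B" "t = b \<otimes>\<^bsub>G\<^esub> a \<otimes>\<^bsub>G\<^esub> inv\<^bsub>G\<^esub> b"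
      using t unfolding T_eq by blast
    have "a \<in> carrier G" "b \<in> carrier G" "c \<in> carrier G"
      using ab c Ac Bc by auto
    \<comment> \<open>Conjugating by \<open>c\<close> merely replaces the conjugator
      \<open>b\<close> by \<open>c \<otimes> b\<close>.\<close>
    then have "c \<otimes>\<^bsub>G\<^esub> t \<otimes>\<^bsub>G\<^esub> inv\<^bsub>G\<^esub> c
        = (c \<otimes>\<^bsub>G\<^esub> b) \<otimes>\<^bsub>G\<^esub> a \<otimes>\<^bsub>G\<^esub> inv\<^bsub>G\<^esub> (c \<otimes>\<^bsub>G\<^esub> b)"
      using ab(3) by (simp add: inv_mult_group m_assoc)
    moreover have "c \<otimes>\<^bsub>G\<^esub> b \<in> H \<inter> B"
      using c ab(2) HB by (rule subgroup.m_closed[rotated])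
    ultimately show ?thesis
      using ab(1) unfolding T_eq by blast
  qed
  have N_conj: "m \<otimes>\<^bsub>G\<^esub> n \<otimes>\<^bsub>G\<^esub> inv\<^bsub>G\<^esub> m \<in> N" if "m \<in> M" "n \<in> N" for m n
    unfolding N_def
  proof (rule generate_conj_closed[OF Tc])
    show "m \<in> carrier G" using that(1) M(2) Bc by auto
    show "m \<otimes>\<^bsub>G\<^esub> t \<otimes>\<^bsub>G\<^esub> inv\<^bsub>G\<^esub> m \<in> T" if "t \<in> T" for t
      using T_conj that \<open>m \<in> M\<close> M(2) by blast
    show "n \<in> generate G T" using that(2) by (simp add: N_def)
  qed
  have "S \<inter> A \<subseteq> T"
  proof
    fix a assume a: "a \<in> S \<inter> A"
    \<comment> \<open>The trivial conjugator shows that the original elements of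
      \<open>S \<inter> A\<close> are among the generators of \<open>N\<close>.\<close>
    then have "a = \<one>\<^bsub>G\<^esub> \<otimes>\<^bsub>G\<^esub> a \<otimes>\<^bsub>G\<^esub> inv\<^bsub>G\<^esub> \<one>\<^bsub>G\<^esub>"
      using Ac by auto
    then show "a \<in> T"
      using a subgroup.one_closed[OF HB] unfolding T_eq by blast
  qed
  then have "S \<subseteq> N \<union> M"
    using assms(6) by (auto simp: N_def M_def intro: generate.incl)
  then have "H \<subseteq> N <#>\<^bsub>G\<^esub> M"
    unfolding H_def using generate_subset_set_mult[OF N(1) M(1)] N_conj by blast
  then have factor: "\<exists>n\<in>N. \<exists>m\<in>M. h = n \<otimes>\<^bsub>G\<^esub> m" if "h \<in> H" for h
    using that unfolding set_mult_def by blast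
  have HA_N: "H \<inter> A = N"
  proof
    show "H \<inter> A \<subseteq> N"
    proof
      fix h assume h: "h \<in> H \<inter> A"
      obtain n m where nm: "n \<in> N" "m \<in> M" "h = n \<otimes>\<^bsub>G\<^esub> m"
        using factor h by blast
      \<comment> \<open>An element of \<open>A\<close> has the factorization with trivial
        \<open>B\<close>-part; comparing it with \<open>n \<otimes> m\<close> by uniqueness in
        \<open>G = [AB]\<close> forces \<open>h = n\<close>.\<close>
      have "h \<otimes>\<^bsub>G\<^esub> \<one>\<^bsub>G\<^esub> = n \<otimes>\<^bsub>G\<^esub> m"
        using nm h Ac by auto
      then have "h = n"
        using unique[of h n "\<one>\<^bsub>G\<^esub>" m] nm h N(2) M(2) B1 by blast
      then show "h \<in> N" using nm by simp
    qed
  qed (rule N(2))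
  have HB_M: "H \<inter> B = M"
  proof
    show "H \<inter> B \<subseteq> M"
    proof
      fix h assume h: "h \<in> H \<inter> B"
      obtain n m where nm: "n \<in> N" "m \<in> M" "h = n \<otimes>\<^bsub>G\<^esub> m"
        using factor h by blast
      \<comment> \<open>Symmetrically, an element of \<open>B\<close> has trivial
        \<open>A\<close>-part, so uniqueness forces \<open>h = m\<close>.\<close>
      have "\<one>\<^bsub>G\<^esub> \<otimes>\<^bsub>G\<^esub> h = n \<otimes>\<^bsub>G\<^esub> m"
        using nm h Bc by auto
      then have "h = m"
        using unique[of "\<one>\<^bsub>G\<^esub>" n h m] nm h N(2) M(2) A1 by blast
      then show "h \<in> M" using nm by simp
    qed
  qed (rule M(2))
  have H_eq: "H = (H \<inter> A) <#>\<^bsub>G\<^esub> (H \<inter> B)"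
  proof
    show "H \<subseteq> (H \<inter> A) <#>\<^bsub>G\<^esub> (H \<inter> B)"
      using \<open>H \<subseteq> N <#>\<^bsub>G\<^esub> M\<close> HA_N HB_M by simp
    show "(H \<inter> A) <#>\<^bsub>G\<^esub> (H \<inter> B) \<subseteq> H"
      using H by (auto simp: set_mult_def intro: subgroup.m_closed)
  qed
  have semi: "inner_semidirect G H (H \<inter> A) (H \<inter> B)"
    unfolding inner_semidirect_def
  proof (intro conjI)
    show "H \<inter> B \<subseteq> normalizer G (H \<inter> A)"
      unfolding subset_normalizer_iff[OF HA HB] using H_conj by blast
    show "H \<inter> A \<inter> (H \<inter> B) = {\<one>\<^bsub>G\<^esub>}"
      using assms(4) subgroup.one_closed[OF H] by (auto simp: inner_semidirect_def)
  qed (use HA HB H_eq in auto)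
  \<comment> \<open>The projections are taken with respect to \<open>A\<close> and \<open>B\<close>.
    By uniqueness they return the factors found here, which lie in \<open>H\<close>; so they map
    \<open>H\<close> into \<open>H \<inter> A\<close> and \<open>H \<inter> B\<close>.\<close>
  have factor': "\<exists>a\<in>H \<inter> A. \<exists>b\<in>H \<inter> B. h = a \<otimes>\<^bsub>G\<^esub> b" if "h \<in> H" for h
    using factor[OF that] HA_N HB_M by simp
  have left: "H \<inter> A = proj_left G A B ` H"
  proof
    show "H \<inter> A \<subseteq> proj_left G A B ` H"
    proof
      fix a assume a: "a \<in> H \<inter> A"
      \<comment> \<open>The projection fixes \<open>A\<close> pointwise, so each \<open>a\<close> in
        \<open>H \<inter> A\<close> is its own preimage.\<close>
      then have "proj_left G A B a = a"
        using proj(1)[of a "\<one>\<^bsub>G\<^esub>"] B1 Ac by auto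
      then show "a \<in> proj_left G A B ` H"
        using a by (metis IntD1 image_eqI)
    qed
    show "proj_left G A B ` H \<subseteq> H \<inter> A"
      using factor' proj(1) by fastforce
  qed
  have right: "H \<inter> B = proj_right G A B ` H"
  proof
    show "H \<inter> B \<subseteq> proj_right G A B ` H"
    proof
      fix b assume b: "b \<in> H \<inter> B"
      then have "proj_right G A B b = b"
        using proj(2)[of "\<one>\<^bsub>G\<^esub>" b] A1 Bc by auto
      then show "b \<in> proj_right G A B ` H"
        using b by (metis IntD1 image_eqI)
    qed
    show "proj_right G A B ` H \<subseteq> H \<inter> B"
      using factor' proj(2) by fastforce
  qed
  show ?thesis
    using semi HA_N left HB_M right unfolding H_def N_def M_def T_def by blast
qed

end
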